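(* (Weak duality) Let $K\subseteq\mathbb{R}^k$ be a nontrivial pointed closed convex cone, let $L\in\mathbb{R}^{k\times n}$, $A\in\mathbb{R}^{m\times n}$, $b\in\mathbb{R}^m$, let $\mathcal{A}=\{x\in\mathbb{R}^n_+ : Ax=b\}$ and $$\mathcal{B}=\{(\lambda,U,v)\in K^{*0}\times\mathbb{R}^{k\times m}\times\mathbb{R}^k : \lambda^Tv=0 \text{ and } (L-UA)^T\lambda\in\mathbb{R}^n_+\}.$$ Then there exist no $x\in\mathcal{A}$ and $(\lambda,U,v)\in\mathcal{B}$ such that $Lx\leq_K Ub+v$.
   Context: $\mathbb{R}^n_+$ denotes the nonnegative orthant. A set $K\subseteq\mathbb{R}^k$ is a cone if $\lambda K\subseteq K$ for all $\lambda\geq 0$; it is nontrivial if $K\neq\{0\}$ and $K\neq\mathbb{R}^k$, and pointed if $K\cap(-K)=\{0\}$. Write $v\leqq_K w$ if $w-v\in K$, and $v\leq_K w$ if $v\leqq_K w$ and $v\neq w$. Set $K^{*0}=\{\lambda\in\mathbb{R}^k:\lambda^Tv>0\ \forall v\in K\setminus\{0\}\}$. *)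

theory Defs
  imports "HOL-Analysis.Analysis"
begin

definition nontrivial_cone :: "'a::real_vector set \<Rightarrow> bool" where
  "nontrivial_cone K \<longleftrightarrow> K \<noteq> {0} \<and> K \<noteq> UNIV"

(* The library's cone admits the empty set; pointedness excludes it. *)
definition pointed_cone :: "'a::real_vector set \<Rightarrow> bool" where
  "pointed_cone K \<longleftrightarrow> K \<inter> uminus ` K = {0}"

definition cone_leqq :: "'a::real_vector set \<Rightarrow> 'a \<Rightarrow> 'a \<Rightarrow> bool" where
  "cone_leqq K v w \<longleftrightarrow> w - v \<in> K"

(* This differs from cone_leqq only by excluding equality; it does not require w - v
   to be an interior point of K. *)
definition cone_leq :: "'a::real_vector set \<Rightarrow> 'a \<Rightarrow> 'a \<Rightarrow> bool" where
  "cone_leq K v w \<longleftrightarrow> cone_leqq K v w \<and> v \<noteq> w"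

definition strict_dual_cone :: "(real ^ 'k) set \<Rightarrow> (real ^ 'k) set" where
  "strict_dual_cone K = {l. \<forall>v \<in> K - {0}. l \<bullet> v > 0}"

definition nonneg_orthant :: "(real ^ 'n) set" where
  "nonneg_orthant = {x. \<forall>i. 0 \<le> x $ i}"

(* A matrix in R^(p x q) has type real ^ 'q ^ 'p: the row index is the outer one. *)
definition primal_feasible :: "real ^ 'n ^ 'm \<Rightarrow> real ^ 'm \<Rightarrow> (real ^ 'n) set" where
  "primal_feasible A b = {x \<in> nonneg_orthant. A *v x = b}"

definition dual_feasible ::
  "(real ^ 'k) set \<Rightarrow> real ^ 'n ^ 'k \<Rightarrow> real ^ 'n ^ 'm
    \<Rightarrow> ((real ^ 'k) \<times> (real ^ 'm ^ 'k) \<times> (real ^ 'k)) set" where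
  "dual_feasible K L A = {(l, U, v). l \<in> strict_dual_cone K \<and> l \<bullet> v = 0 \<and>
      transpose (L - U ** A) *v l \<in> nonneg_orthant}"

end

theory Submission
  imports Defs
begin

text \<open>Pair the gap \<open>U *v b + v - L *v x\<close> with \<open>l\<close>. The gap is a
  nonzero element of \<open>K\<close>, so strict duality makes the pairing positive. Since
  \<open>b\<close> is \<open>A *v x\<close> and \<open>l\<close> annihilates \<open>v\<close>, the
  pairing is also minus the inner product of \<open>transpose (L - U ** A) *v l\<close> with
  \<open>x\<close>; both vectors are nonnegative, so it is at most 0.\<close>

theorem theorem2:
  fixes K :: "(real ^ 'k) set"
    and L :: "real ^ 'n ^ 'k"
    and A :: "real ^ 'n ^ 'm"
    and b :: "real ^ 'm"
  assumes "cone K" and "convex K" and "closed K"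
    and "nontrivial_cone K" and "pointed_cone K"
  shows "\<not> (\<exists>x l U v. x \<in> primal_feasible A b \<and> (l, U, v) \<in> dual_feasible K L A \<and>
            cone_leq K (L *v x) (U *v b + v))"
proof
  assume "\<exists>x l U v. x \<in> primal_feasible A b \<and> (l, U, v) \<in> dual_feasible K L A \<and>
            cone_leq K (L *v x) (U *v b + v)"
  then obtain x l U v
    where x: "x \<in> nonneg_orthant" "A *v x = b"
      and l: "l \<in> strict_dual_cone K" "l \<bullet> v = 0"
      and M: "transpose (L - U ** A) *v l \<in> nonneg_orthant"
      and le: "U *v b + v - L *v x \<in> K" "L *v x \<noteq> U *v b + v"
    unfolding primal_feasible_def dual_feasible_def cone_leq_def cone_leqq_def by auto
  have "0 < l \<bullet> (U *v b + v - L *v x)"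
    using l(1) le unfolding strict_dual_cone_def by auto
  \<comment> \<open>The flipped associativity law splits \<open>(U ** A) *v x\<close> so that
    \<open>A *v x\<close> appears and becomes \<open>b\<close>.\<close>
  also have "\<dots> = - (l \<bullet> ((L - U ** A) *v x))"
    using l(2) x(2)
    by (simp add: matrix_vector_mult_diff_rdistrib inner_diff_right inner_add_right
        flip: matrix_vector_mul_assoc)
  also have "\<dots> = - ((transpose (L - U ** A) *v l) \<bullet> x)"
    by (simp add: dot_lmul_matrix)
  also have "\<dots> \<le> 0"
    using M x(1) by (simp add: nonneg_orthant_def inner_vec_def sum_nonneg)
  finally show False by simp
qed

end
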